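(* For every two infinite compact spaces $K$ and $L$, their product $K\times L$ does not have the $\ell_1$-Grothendieck property.
   Context: All compact spaces are Hausdorff. For a compact space $M$, measures are signed Radon measures on $M$, and $\ell_1(M)$ is the space of all countably supported measures on $M$ (of the form $\sum_x\alpha_x\delta_x$ with $\sum_x|\alpha_x|<\infty$). A sequence of measures $\mu_n$ on $M$ is weakly* convergent to $\mu$ if $\int_M f\,d\mu_n\to\int_M f\,d\mu$ for all $f\in C(M)$, and weakly convergent to $\mu$ if $\mu_n(B)\to\mu(B)$ for all Borel $B\subseteq M$. $M$ has the $\ell_1$-Grothendieck property if every weakly* convergent sequence of measures from $\ell_1(M)$ is weakly convergent. *)

theory Defs
  imports "HOL-Analysis.Analysis"
begin

definition borel_sets_of :: "'a topology \<Rightarrow> 'a set set" where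
  "borel_sets_of X = sigma_sets (topspace X) {U. openin X U}"

text \<open>A signed measure is represented by its real-valued set function; only the values on Borel
  sets matter, the values on other sets are unconstrained junk.\<close>

definition signed_borel_measure :: "'a topology \<Rightarrow> ('a set \<Rightarrow> real) \<Rightarrow> bool" where
  "signed_borel_measure X \<mu> \<longleftrightarrow>
     \<mu> {} = 0 \<and>
     (\<forall>A :: nat \<Rightarrow> 'a set. range A \<subseteq> borel_sets_of X \<longrightarrow> disjoint_family A \<longrightarrow>
        (\<lambda>n. \<mu> (A n)) sums \<mu> (\<Union>n. A n))"

text \<open>The Jordan decomposition: the positive part is
  \<open>\<mu>\<^sup>+(B) = sup {\<mu>(A) | A \<subseteq> B Borel}\<close>. The truncation of negative reals by \<^const>\<open>ennreal\<close> is
  harmless because \<open>A = {}\<close> contributes the value 0. For a signed measure this set function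
  is a (finite) measure, so that \<^const>\<open>measure_of\<close> does not fall back to the zero measure.\<close>

definition positive_part :: "'a topology \<Rightarrow> ('a set \<Rightarrow> real) \<Rightarrow> 'a measure" where
  "positive_part X \<mu> =
     measure_of (topspace X) (borel_sets_of X)
       (\<lambda>B. SUP A\<in>{A \<in> borel_sets_of X. A \<subseteq> B}. ennreal (\<mu> A))"

definition negative_part :: "'a topology \<Rightarrow> ('a set \<Rightarrow> real) \<Rightarrow> 'a measure" where
  "negative_part X \<mu> = positive_part X (\<lambda>B. - \<mu> B)"

definition total_variation :: "'a topology \<Rightarrow> ('a set \<Rightarrow> real) \<Rightarrow> 'a set \<Rightarrow> ennreal" where
  "total_variation X \<mu> B = emeasure (positive_part X \<mu>) B + emeasure (negative_part X \<mu>) B"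

definition signed_Radon_measure :: "'a topology \<Rightarrow> ('a set \<Rightarrow> real) \<Rightarrow> bool" where
  "signed_Radon_measure X \<mu> \<longleftrightarrow>
     signed_borel_measure X \<mu> \<and>
     (\<forall>B\<in>borel_sets_of X.
        total_variation X \<mu> B = (SUP C\<in>{C. compactin X C \<and> C \<subseteq> B}. total_variation X \<mu> C))"

definition signed_integral :: "'a topology \<Rightarrow> ('a set \<Rightarrow> real) \<Rightarrow> ('a \<Rightarrow> real) \<Rightarrow> real" where
  "signed_integral X \<mu> f =
     integral\<^sup>L (positive_part X \<mu>) f - integral\<^sup>L (negative_part X \<mu>) f"

text \<open>Here \<open>indicator B x\<close> is \<open>\<delta>\<^sub>x(B)\<close>. Countability of the support of \<open>\<alpha>\<close> is implied by
  absolute summability.\<close>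

definition l1_measures :: "'a topology \<Rightarrow> ('a set \<Rightarrow> real) set" where
  "l1_measures X =
     {\<mu>. signed_Radon_measure X \<mu> \<and>
         (\<exists>\<alpha> :: 'a \<Rightarrow> real. (\<lambda>x. \<bar>\<alpha> x\<bar>) summable_on topspace X \<and>
            (\<forall>B\<in>borel_sets_of X. \<mu> B = (\<Sum>\<^sub>\<infinity>x\<in>topspace X. \<alpha> x * indicator B x)))}"

definition weak_star_converges_to ::
    "'a topology \<Rightarrow> (nat \<Rightarrow> 'a set \<Rightarrow> real) \<Rightarrow> ('a set \<Rightarrow> real) \<Rightarrow> bool" where
  "weak_star_converges_to X \<mu> \<nu> \<longleftrightarrow>
     (\<forall>f. continuous_map X euclideanreal f \<longrightarrow>
        (\<lambda>n. signed_integral X (\<mu> n) f) \<longlonglongrightarrow> signed_integral X \<nu> f)"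

definition weakly_converges_to ::
    "'a topology \<Rightarrow> (nat \<Rightarrow> 'a set \<Rightarrow> real) \<Rightarrow> ('a set \<Rightarrow> real) \<Rightarrow> bool" where
  "weakly_converges_to X \<mu> \<nu> \<longleftrightarrow>
     (\<forall>B\<in>borel_sets_of X. (\<lambda>n. \<mu> n B) \<longlonglongrightarrow> \<nu> B)"

text \<open>The two limits are not required to coincide in the definition; on a compact Hausdorff
  space they automatically agree on Borel sets.\<close>

definition l1_Grothendieck_property :: "'a topology \<Rightarrow> bool" where
  "l1_Grothendieck_property X \<longleftrightarrow>
     (\<forall>\<mu> :: nat \<Rightarrow> 'a set \<Rightarrow> real.
        (\<forall>n. \<mu> n \<in> l1_measures X) \<longrightarrow>
        (\<exists>\<nu>. signed_Radon_measure X \<nu> \<and> weak_star_converges_to X \<mu> \<nu>) \<longrightarrow>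
        (\<exists>\<nu>. signed_Radon_measure X \<nu> \<and> weakly_converges_to X \<mu> \<nu>))"

end

theory Submission imports Defs
begin

text \<open>On a finite set of signs, independent random signs make averages small: for real numbers
  \<open>h\<^sub>1, \<dots>, h\<^sub>n\<close> bounded by \<open>C\<close>, the mean of \<open>\<bar>\<epsilon>\<^sub>1 h\<^sub>1 + \<dots> + \<epsilon>\<^sub>n h\<^sub>n\<bar> / n\<close> over all
  \<open>2\<^sup>n\<close> choices of signs is at most \<open>C / \<surd>n\<close>. This is turned into a sequence of measures on the
  product as follows. Choose distinct points \<open>y\<^sub>i\<close> of \<open>L\<close>, and distinct points \<open>x\<^bsub>n,S\<^esub>\<close> of \<open>K\<close>, one for
  every \<open>n\<close> and every \<open>S \<subseteq> {..<n}\<close>, where \<open>S\<close> stands for the sign pattern that is \<open>1\<close> on \<open>S\<close> and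
  \<open>-1\<close> off \<open>S\<close>. Let \<open>\<mu>\<^sub>n\<close> put the mass \<open>\<plusminus>1 / (n 2\<^sup>n)\<close> at \<open>(x\<^bsub>n,S\<^esub>, y\<^sub>i)\<close>, with the sign that \<open>S\<close>
  gives to \<open>i\<close>.

  The sequence is weakly* null. For a product \<open>f(x) g(y)\<close> of bounded functions this is the estimate
  above. A continuous function on \<open>K \<times> L\<close> is close to such functions in the following sense: its
  sections \<open>f(x, \<cdot>)\<close> form a totally bounded set for the uniform norm
  (\<open>finite_net_of_sections\<close>), so that, up to an error \<open>\<epsilon>\<close>, only finitely many sections \<open>h\<close> occur,
  and their contributions may simply be added up
  (\<open>sum_abs_sign_sum_le\<close>, \<open>rademacher_integral_bound\<close>).

  The sequence is not weakly convergent. For different \<open>n\<close> the supports are disjoint, so the set \<open>B\<close>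
  of all positive atoms of the \<open>\<mu>\<^sub>n\<close> with \<open>n\<close> even meets the support of \<open>\<mu>\<^sub>n\<close> only for even \<open>n\<close>.
  It is countable, hence Borel, and from \<open>n = 1\<close> on \<open>\<mu>\<^sub>n(B)\<close> alternates between \<open>1/2\<close> and \<open>0\<close>
  (\<open>rademacher_measure_positive_atoms\<close>).

  The remaining work relates finite sums of point masses to the Jordan decomposition by which
  integrals and total variations are defined: the positive part keeps exactly the
  positive masses (\<open>positive_part_finite_atomic\<close>).\<close>

section \<open>Finitely supported signed measures\<close>

definition finite_atomic :: "'a set \<Rightarrow> ('a \<Rightarrow> real) \<Rightarrow> 'a set \<Rightarrow> real" where
  "finite_atomic P \<alpha> B = (\<Sum>p\<in>P. \<alpha> p * indicator B p)"

lemma borel_sets_of_subset: "borel_sets_of X \<subseteq> Pow (topspace X)"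
  unfolding borel_sets_of_def
  by (auto dest: openin_subset sigma_sets_into_sp[rotated])

lemma sigma_algebra_borel_sets_of: "sigma_algebra (topspace X) (borel_sets_of X)"
  unfolding borel_sets_of_def by (rule sigma_algebra_sigma_sets) (auto dest: openin_subset)

lemma borel_sets_of_openin: "openin X U \<Longrightarrow> U \<in> borel_sets_of X"
  by (auto simp: borel_sets_of_def)

lemma borel_sets_of_closedin:
  assumes "closedin X C" shows "C \<in> borel_sets_of X"
proof -
  have "topspace X - (topspace X - C) \<in> borel_sets_of X"
    using assms unfolding borel_sets_of_def by (intro sigma_sets.Compl sigma_sets.Basic) auto
  then show ?thesis
    using closedin_subset[OF assms] by (simp add: double_diff)
qed

lemma borel_sets_of_countable:
  assumes "t1_space X" "countable C" "C \<subseteq> topspace X"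
  shows "C \<in> borel_sets_of X"
proof -
  interpret sigma_algebra "topspace X" "borel_sets_of X"
    by (rule sigma_algebra_borel_sets_of)
  have "(\<Union>p\<in>C. {p}) \<in> borel_sets_of X"
    using assms by (intro countable_UN') (auto intro!: borel_sets_of_closedin closedin_t1_singleton)
  then show ?thesis by simp
qed

text \<open>The inclusion of the finite discrete space \<open>P\<close> transports its point masses to \<open>X\<close>. In this
  form, values and integrals reduce to finite sums by the change of variables formula.\<close>
definition atomic_measure :: "'a topology \<Rightarrow> 'a set \<Rightarrow> ('a \<Rightarrow> real) \<Rightarrow> 'a measure" where
  "atomic_measure X P c =
     distr (point_measure P (\<lambda>p. ennreal (c p))) (sigma (topspace X) (borel_sets_of X)) (\<lambda>p. p)"

lemma space_atomic_measure: "space (atomic_measure X P c) = topspace X"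
  by (simp add: atomic_measure_def space_measure_of_conv)

lemma sets_atomic_measure: "sets (atomic_measure X P c) = borel_sets_of X"
  by (simp add: atomic_measure_def borel_sets_of_subset
      sigma_algebra.sigma_sets_eq[OF sigma_algebra_borel_sets_of])

lemma measurable_inclusion:
  assumes "P \<subseteq> topspace X"
  shows "(\<lambda>p. p) \<in> measurable (point_measure P c) (sigma (topspace X) (borel_sets_of X))"
  using assms by (auto simp: measurable_def space_point_measure sets_point_measure space_measure_of_conv)

lemma emeasure_atomic_measure:
  assumes "finite P" "P \<subseteq> topspace X" "B \<in> borel_sets_of X"
  shows "emeasure (atomic_measure X P c) B = (\<Sum>p\<in>P \<inter> B. ennreal (c p))"
  using assms unfolding atomic_measure_def
  by (subst emeasure_distr[OF measurable_inclusion])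
    (auto simp: borel_sets_of_subset sigma_algebra.sigma_sets_eq[OF sigma_algebra_borel_sets_of]
      space_point_measure emeasure_point_measure_finite Int_commute)

lemma integral_atomic_measure:
  fixes f :: "'a \<Rightarrow> real"
  assumes "finite P" "P \<subseteq> topspace X" "\<And>p. p \<in> P \<Longrightarrow> 0 \<le> c p" "continuous_map X euclideanreal f"
  shows "integral\<^sup>L (atomic_measure X P c) f = (\<Sum>p\<in>P. c p * f p)"
proof -
  have "f \<in> borel_measurable (sigma (topspace X) (borel_sets_of X))"
  proof (rule borel_measurableI)
    fix S :: "real set" assume "open S"
    then have "openin X {x \<in> topspace X. f x \<in> S}"
      using assms(4) by (simp add: continuous_map)
    then show "f -` S \<inter> space (sigma (topspace X) (borel_sets_of X))
        \<in> sets (sigma (topspace X) (borel_sets_of X))"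
      by (auto simp: space_measure_of_conv borel_sets_of_subset vimage_def Int_def conj_commute
          intro!: sigma_sets.Basic borel_sets_of_openin)
  qed
  then show ?thesis
    using assms(1-3) unfolding atomic_measure_def
    by (simp add: integral_distr[OF measurable_inclusion] lebesgue_integral_point_measure_finite)
qed

text \<open>The supremum defining the positive part at \<open>B\<close> is attained at the finite, hence Borel, set of
  those points of \<open>P \<inter> B\<close> that carry positive mass.\<close>
lemma positive_part_finite_atomic:
  assumes X: "t1_space X" and P: "finite P" "P \<subseteq> topspace X"
  shows "positive_part X (finite_atomic P \<alpha>) = atomic_measure X P (\<lambda>p. max 0 (\<alpha> p))"
proof -
  have sup: "(SUP A\<in>{A \<in> borel_sets_of X. A \<subseteq> B}. ennreal (finite_atomic P \<alpha> A))
      = (\<Sum>p\<in>P \<inter> B. ennreal (max 0 (\<alpha> p)))" (is "?l = ?r") if "B \<in> borel_sets_of X" for B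
  proof (rule antisym)
    show "?l \<le> ?r"
    proof (rule SUP_least)
      fix A assume "A \<in> {A \<in> borel_sets_of X. A \<subseteq> B}"
      then have "finite_atomic P \<alpha> A \<le> (\<Sum>p\<in>P. max 0 (\<alpha> p) * indicator B p)"
        unfolding finite_atomic_def by (intro sum_mono) (auto split: split_indicator)
      also have "\<dots> = (\<Sum>p\<in>P \<inter> B. max 0 (\<alpha> p))"
        using P by (simp add: indicator_def of_bool_def sum.If_cases if_distrib cong: if_cong)
      finally show "ennreal (finite_atomic P \<alpha> A) \<le> ?r"
        by (simp add: ennreal_leI)
    qed
    let ?A = "{p \<in> P \<inter> B. 0 < \<alpha> p}"
    have A: "?A \<in> borel_sets_of X"
      using P X by (intro borel_sets_of_countable) (auto intro: countable_finite)
    have "?r = ennreal (\<Sum>p\<in>P \<inter> B. max 0 (\<alpha> p))"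
      by simp
    also have "(\<Sum>p\<in>P \<inter> B. max 0 (\<alpha> p)) = finite_atomic P \<alpha> ?A"
      unfolding finite_atomic_def using P
      by (intro sum.mono_neutral_cong_left) (auto split: split_indicator)
    also have "ennreal \<dots> \<le> ?l"
      using A by (intro SUP_upper) auto
    finally show "?r \<le> ?l" .
  qed
  have "positive_part X (finite_atomic P \<alpha>)
      = measure_of (topspace X) (borel_sets_of X) (emeasure (atomic_measure X P (\<lambda>p. max 0 (\<alpha> p))))"
    unfolding positive_part_def
  proof (rule measure_of_eq[OF borel_sets_of_subset])
    fix B assume "B \<in> sigma_sets (topspace X) (borel_sets_of X)"
    then have "B \<in> borel_sets_of X"
      by (simp add: sigma_algebra.sigma_sets_eq[OF sigma_algebra_borel_sets_of])
    then show "(SUP A\<in>{A \<in> borel_sets_of X. A \<subseteq> B}. ennreal (finite_atomic P \<alpha> A))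
        = emeasure (atomic_measure X P (\<lambda>p. max 0 (\<alpha> p))) B"
      using sup emeasure_atomic_measure[OF P] by metis
  qed
  also have "\<dots> = atomic_measure X P (\<lambda>p. max 0 (\<alpha> p))"
    using measure_of_of_measure[of "atomic_measure X P (\<lambda>p. max 0 (\<alpha> p))"]
    by (simp add: space_atomic_measure sets_atomic_measure)
  finally show ?thesis .
qed

lemma negative_part_finite_atomic:
  assumes "t1_space X" "finite P" "P \<subseteq> topspace X"
  shows "negative_part X (finite_atomic P \<alpha>) = atomic_measure X P (\<lambda>p. max 0 (- \<alpha> p))"
proof -
  have "(\<lambda>B. - finite_atomic P \<alpha> B) = finite_atomic P (\<lambda>p. - \<alpha> p)"
    by (auto simp: finite_atomic_def sum_negf)
  then show ?thesis
    using positive_part_finite_atomic[OF assms] by (simp add: negative_part_def)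
qed

lemma signed_integral_finite_atomic:
  assumes "t1_space X" "finite P" "P \<subseteq> topspace X" "continuous_map X euclideanreal f"
  shows "signed_integral X (finite_atomic P \<alpha>) f = (\<Sum>p\<in>P. \<alpha> p * f p)"
proof -
  have "max 0 (\<alpha> p) * f p - max 0 (- \<alpha> p) * f p = \<alpha> p * f p" for p
    by (auto simp: max_def)
  then show ?thesis
    using assms
    by (simp add: signed_integral_def positive_part_finite_atomic negative_part_finite_atomic
        integral_atomic_measure flip: sum_subtractf)
qed

lemma signed_borel_measure_finite_atomic:
  assumes "finite P"
  shows "signed_borel_measure X (finite_atomic P \<alpha>)"
  unfolding signed_borel_measure_def finite_atomic_def
  by (auto intro!: sums_sum sums_mult indicator_sums simp: disjoint_family_on_def)

lemma total_variation_mono: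
  assumes "B \<in> borel_sets_of X" "C \<subseteq> B"
  shows "total_variation X \<mu> C \<le> total_variation X \<mu> B"
proof -
  have "B \<in> sets (positive_part X \<nu>)" for \<nu>
    using assms by (simp add: positive_part_def borel_sets_of_subset
        sigma_algebra.sigma_sets_eq[OF sigma_algebra_borel_sets_of])
  then show ?thesis
    using assms(2) unfolding total_variation_def negative_part_def
    by (intro add_mono emeasure_mono) auto
qed

text \<open>Inner regularity is immediate because the total variation of \<open>B\<close> is already attained on the
  finite set \<open>P \<inter> B\<close>.\<close>
lemma signed_Radon_measure_finite_atomic:
  assumes X: "t1_space X" and P: "finite P" "P \<subseteq> topspace X"
  shows "signed_Radon_measure X (finite_atomic P \<alpha>)"
  unfolding signed_Radon_measure_def
proof (intro conjI ballI antisym)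
  show "signed_borel_measure X (finite_atomic P \<alpha>)"
    using P(1) by (rule signed_borel_measure_finite_atomic)
  fix B assume B: "B \<in> borel_sets_of X"
  let ?v = "total_variation X (finite_atomic P \<alpha>)"
  have PB: "P \<inter> B \<in> borel_sets_of X"
    using P X by (intro borel_sets_of_countable) (auto intro: countable_finite)
  have "?v B = ?v (P \<inter> B)"
    using B PB X P
    by (simp add: total_variation_def positive_part_finite_atomic negative_part_finite_atomic
        emeasure_atomic_measure flip: Int_assoc)
  also have "\<dots> \<le> (SUP C\<in>{C. compactin X C \<and> C \<subseteq> B}. ?v C)"
    using P by (intro SUP_upper) (auto intro: finite_imp_compactin)
  finally show "?v B \<le> (SUP C\<in>{C. compactin X C \<and> C \<subseteq> B}. ?v C)" .
  show "(SUP C\<in>{C. compactin X C \<and> C \<subseteq> B}. ?v C) \<le> ?v B"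
    using B by (intro SUP_least total_variation_mono) auto
qed

lemma finite_atomic_in_l1_measures:
  assumes "t1_space X" and P: "finite P" "P \<subseteq> topspace X"
  shows "finite_atomic P \<alpha> \<in> l1_measures X"
proof -
  let ?\<alpha> = "\<lambda>x. if x \<in> P then \<alpha> x else 0"
  have "(\<lambda>x. \<bar>?\<alpha> x\<bar>) summable_on topspace X"
    using P by (subst summable_on_cong_neutral[where T = P]) auto
  moreover have "finite_atomic P \<alpha> B = (\<Sum>\<^sub>\<infinity>x\<in>topspace X. ?\<alpha> x * indicator B x)" for B
  proof -
    have "(\<Sum>\<^sub>\<infinity>x\<in>topspace X. ?\<alpha> x * indicator B x) = (\<Sum>\<^sub>\<infinity>x\<in>P. \<alpha> x * indicator B x)"
      using P by (intro infsum_cong_neutral) auto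
    then show ?thesis
      using P by (simp add: finite_atomic_def)
  qed
  ultimately show ?thesis
    using signed_Radon_measure_finite_atomic[OF assms, of \<alpha>] unfolding l1_measures_def
    by (intro CollectI conjI exI[of _ ?\<alpha>] ballI)
qed

section \<open>Averages over random signs\<close>

text \<open>The \<open>2\<^sup>n\<close> sign patterns on an \<open>n\<close>-element set are encoded by its subsets.\<close>
definition sign_of :: "'i set \<Rightarrow> 'i \<Rightarrow> real" where
  "sign_of S i = (if i \<in> S then 1 else -1)"

lemma sum_Pow_insert:
  fixes g :: "'i set \<Rightarrow> real"
  assumes "finite I" "a \<notin> I"
  shows "(\<Sum>S\<in>Pow (insert a I). g S) = (\<Sum>S\<in>Pow I. g S + g (insert a S))"
proof -
  have "inj_on (insert a) (Pow I)" "Pow I \<inter> insert a ` Pow I = {}"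
    using assms(2) by (auto simp: inj_on_def)
  then show ?thesis
    using assms(1) by (simp add: Pow_insert sum.union_disjoint sum.reindex sum.distrib)
qed

text \<open>Orthogonality of independent random signs. Adding a new index \<open>a\<close> pairs the two possible signs
  of \<open>a\<close>, and the mixed terms cancel by the parallelogram identity
  \<open>(t - h)\<^sup>2 + (t + h)\<^sup>2 = 2 t\<^sup>2 + 2 h\<^sup>2\<close>.\<close>
lemma sign_sum_second_moment:
  fixes h :: "'i \<Rightarrow> real"
  assumes "finite I"
  shows "(\<Sum>S\<in>Pow I. (\<Sum>i\<in>I. sign_of S i * h i)\<^sup>2) = 2 ^ card I * (\<Sum>i\<in>I. (h i)\<^sup>2)"
  using assms
proof (induction I)
  case empty
  then show ?case by simp
next
  case (insert a I)
  let ?T = "\<lambda>S. \<Sum>i\<in>I. sign_of S i * h i"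
  have pair: "(\<Sum>i\<in>insert a I. sign_of S i * h i)\<^sup>2 + (\<Sum>i\<in>insert a I. sign_of (insert a S) i * h i)\<^sup>2
      = 2 * (?T S)\<^sup>2 + 2 * (h a)\<^sup>2" if "S \<in> Pow I" for S
  proof -
    have "(\<Sum>i\<in>I. sign_of (insert a S) i * h i) = ?T S"
      using insert by (intro sum.cong) (auto simp: sign_of_def)
    moreover have "sign_of S a = -1" "sign_of (insert a S) a = 1"
      using that insert by (auto simp: sign_of_def)
    ultimately show ?thesis
      using insert by (simp add: power2_eq_square algebra_simps)
  qed
  have "(\<Sum>S\<in>Pow (insert a I). (\<Sum>i\<in>insert a I. sign_of S i * h i)\<^sup>2)
      = (\<Sum>S\<in>Pow I. 2 * (?T S)\<^sup>2 + 2 * (h a)\<^sup>2)"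
    using insert pair by (subst sum_Pow_insert) (auto intro!: sum.cong)
  also have "\<dots> = 2 ^ card (insert a I) * (\<Sum>i\<in>insert a I. (h i)\<^sup>2)"
    using insert by (simp add: sum.distrib card_Pow algebra_simps flip: sum_distrib_left)
  finally show ?case .
qed

text \<open>The Cauchy--Schwarz inequality over the \<open>2 ^ card I\<close> sign patterns turns the second moment into
  a bound that is smaller than the trivial one, \<open>card I * C\<close> per pattern, by the factor
  \<open>sqrt (card I)\<close>.\<close>
lemma sign_sum_first_moment:
  fixes h :: "'i \<Rightarrow> real"
  assumes I: "finite I" and C: "\<And>i. i \<in> I \<Longrightarrow> \<bar>h i\<bar> \<le> C" "0 \<le> C"
  shows "(\<Sum>S\<in>Pow I. \<bar>\<Sum>i\<in>I. sign_of S i * h i\<bar>) \<le> 2 ^ card I * (sqrt (card I) * C)"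
proof -
  let ?T = "\<lambda>S. \<bar>\<Sum>i\<in>I. sign_of S i * h i\<bar>"
  have "(\<Sum>i\<in>I. (h i)\<^sup>2) \<le> (\<Sum>i\<in>I. C\<^sup>2)"
    using C by (intro sum_mono) (metis abs_le_square_iff abs_of_nonneg)
  then have "(\<Sum>S\<in>Pow I. (?T S)\<^sup>2) \<le> 2 ^ card I * (card I * C\<^sup>2)"
    using I by (simp add: sign_sum_second_moment)
  then have "2 ^ card I * (\<Sum>S\<in>Pow I. (?T S)\<^sup>2) \<le> 2 ^ card I * (2 ^ card I * (card I * C\<^sup>2))"
    by (intro mult_left_mono) auto
  moreover have "(\<Sum>S\<in>Pow I. ?T S)\<^sup>2 \<le> 2 ^ card I * (\<Sum>S\<in>Pow I. (?T S)\<^sup>2)"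
    using I sum_squared_le_sum_of_squares[of ?T "Pow I"] by (simp add: card_Pow mult.commute)
  moreover have "2 ^ card I * (2 ^ card I * (card I * C\<^sup>2)) = (2 ^ card I * (sqrt (card I) * C))\<^sup>2"
    by (simp add: power_mult_distrib power2_eq_square[of "2 ^ card I"] mult.assoc)
  ultimately have "(\<Sum>S\<in>Pow I. ?T S)\<^sup>2 \<le> (2 ^ card I * (sqrt (card I) * C))\<^sup>2"
    by linarith
  then show ?thesis
    by (rule power2_le_imp_le) (use C(2) in auto)
qed

text \<open>Complementation permutes the subsets of \<open>I\<close>, so their average size is half of \<open>card I\<close>.\<close>
lemma sum_card_Pow:
  assumes "finite I"
  shows "2 * (\<Sum>S\<in>Pow I. real (card S)) = card I * 2 ^ card I"
proof -
  have "(\<Sum>S\<in>Pow I. real (card S)) = (\<Sum>S\<in>Pow I. real (card (I - S)))"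
    by (rule sum.reindex_bij_witness[of _ "\<lambda>S. I - S" "\<lambda>S. I - S"])
      (auto simp: double_diff)
  also have "\<dots> = (\<Sum>S\<in>Pow I. real (card I) - card S)"
    using assms by (intro sum.cong) (auto simp: card_Diff_subset finite_subset card_mono of_nat_diff)
  finally show ?thesis
    using assms by (simp add: sum_subtractf card_Pow)
qed

text \<open>Here the function \<open>g S\<close> that is integrated against the signs may depend on the sign pattern \<open>S\<close>,
  so that the moment bound does not apply to it directly; \<open>g S = sign_of S\<close> would give no
  cancellation at all. If \<open>g S\<close> stays close to a finite family \<open>h\<close>, bounding the nearby
  member by the sum over the whole family removes the dependence on \<open>S\<close>.\<close>
lemma sum_abs_sign_sum_le:
  fixes g :: "'i set \<Rightarrow> 'i \<Rightarrow> real" and h :: "'j \<Rightarrow> 'i \<Rightarrow> real" and C e :: real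
  assumes I: "finite I" and J: "finite J" and "0 \<le> C"
    and C: "\<And>j i. j \<in> J \<Longrightarrow> i \<in> I \<Longrightarrow> \<bar>h j i\<bar> \<le> C"
    and near: "\<And>S. S \<subseteq> I \<Longrightarrow> \<exists>j\<in>J. \<forall>i\<in>I. \<bar>g S i - h j i\<bar> \<le> e"
  shows "(\<Sum>S\<in>Pow I. \<bar>\<Sum>i\<in>I. sign_of S i * g S i\<bar>)
    \<le> 2 ^ card I * (card J * (sqrt (card I) * C) + card I * e)"
proof -
  let ?T = "\<lambda>S j. \<bar>\<Sum>i\<in>I. sign_of S i * h j i\<bar>"
  have "\<bar>\<Sum>i\<in>I. sign_of S i * g S i\<bar> \<le> (\<Sum>j\<in>J. ?T S j) + card I * e" if S: "S \<in> Pow I" for S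
  proof -
    obtain j where j: "j \<in> J" "\<And>i. i \<in> I \<Longrightarrow> \<bar>g S i - h j i\<bar> \<le> e"
      using near S by blast
    have "(\<Sum>i\<in>I. sign_of S i * g S i)
        = (\<Sum>i\<in>I. sign_of S i * h j i) + (\<Sum>i\<in>I. sign_of S i * (g S i - h j i))"
      by (simp add: algebra_simps flip: sum.distrib)
    moreover have "\<bar>\<Sum>i\<in>I. sign_of S i * (g S i - h j i)\<bar> \<le> (\<Sum>i\<in>I. e)"
      using j by (intro order_trans[OF sum_abs] sum_mono) (auto simp: abs_mult sign_of_def)
    moreover have "?T S j \<le> (\<Sum>j\<in>J. ?T S j)"
      using j J by (intro member_le_sum) auto
    ultimately show ?thesis by simp
  qed
  then have "(\<Sum>S\<in>Pow I. \<bar>\<Sum>i\<in>I. sign_of S i * g S i\<bar>)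
      \<le> (\<Sum>S\<in>Pow I. (\<Sum>j\<in>J. ?T S j) + card I * e)"
    by (rule sum_mono)
  also have "\<dots> = (\<Sum>j\<in>J. \<Sum>S\<in>Pow I. ?T S j) + 2 ^ card I * (card I * e)"
    using I by (simp add: sum.distrib card_Pow sum.swap[of _ "Pow I" J])
  also have "\<dots> \<le> (\<Sum>j\<in>J. 2 ^ card I * (sqrt (card I) * C)) + 2 ^ card I * (card I * e)"
    using C I \<open>0 \<le> C\<close> by (intro add_right_mono sum_mono sign_sum_first_moment)
  finally show ?thesis
    by (simp add: algebra_simps)
qed

section \<open>Total boundedness of the sections of a continuous function\<close>

text \<open>The sections \<open>f (x, \<cdot>)\<close> are totally bounded: the points \<open>x\<close> whose section is uniformly
  \<open>e\<close>-close to that of \<open>j\<close> form an open set, because the complement is the projection of a closed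
  set along the compact space \<open>L\<close>, and finitely many of these open sets cover \<open>K\<close>.\<close>
lemma finite_net_of_sections:
  fixes f :: "'a \<times> 'b \<Rightarrow> real"
  assumes K: "compact_space K" and L: "compact_space L"
    and f: "continuous_map (prod_topology K L) euclideanreal f" and "0 < e"
  obtains J where "finite J" "J \<subseteq> topspace K"
    "\<And>x. x \<in> topspace K \<Longrightarrow> \<exists>j\<in>J. \<forall>y\<in>topspace L. \<bar>f (x, y) - f (j, y)\<bar> < e"
proof -
  define U where "U j = {x \<in> topspace K. \<forall>y\<in>topspace L. \<bar>f (x, y) - f (j, y)\<bar> < e}" for j
  have openU: "openin K (U j)" if j: "j \<in> topspace K" for j
  proof -
    define g where "g z = \<bar>f z - f (j, snd z)\<bar>" for z
    have "continuous_map (prod_topology K L) (prod_topology K L) (\<lambda>z. (j, snd z))"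
      using j by (simp add: continuous_map_pairwise o_def continuous_map_snd)
    from continuous_map_compose[OF this f]
    have g: "continuous_map (prod_topology K L) euclideanreal g"
      unfolding g_def o_def by (intro continuous_map_real_abs continuous_map_diff f)
    have "closedin (prod_topology K L) {z \<in> topspace (prod_topology K L). g z \<in> {e..}}"
      by (rule closedin_continuous_map_preimage[OF g]) auto
    then have "closedin K (fst ` {z \<in> topspace (prod_topology K L). g z \<in> {e..}})"
      using closed_map_fst[OF L] unfolding closed_map_def by blast
    then have "openin K (topspace K - fst ` {z \<in> topspace (prod_topology K L). g z \<in> {e..}})"
      by auto
    also have "topspace K - fst ` {z \<in> topspace (prod_topology K L). g z \<in> {e..}} = U j"
      unfolding U_def g_def by (force simp: image_iff)
    finally show ?thesis .
  qed
  have "topspace K \<subseteq> \<Union> (U ` topspace K)"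
    using \<open>0 < e\<close> by (auto simp: U_def)
  then obtain F where F: "finite F" "F \<subseteq> U ` topspace K" "topspace K \<subseteq> \<Union>F"
    using K openU unfolding compact_space_alt by (metis (no_types, lifting) imageE)
  then obtain J where J: "J \<subseteq> topspace K" "finite J" "F = U ` J"
    by (meson finite_subset_image)
  show thesis
  proof (rule that[OF J(2,1)])
    fix x assume "x \<in> topspace K"
    then obtain j where "j \<in> J" "x \<in> U j" using F J by auto
    then show "\<exists>j\<in>J. \<forall>y\<in>topspace L. \<bar>f (x, y) - f (j, y)\<bar> < e"
      by (auto simp: U_def)
  qed
qed

lemma bounded_continuous_map_compact:
  fixes f :: "'a \<Rightarrow> real"
  assumes "compact_space X" "continuous_map X euclideanreal f"
  obtains C where "0 \<le> C" "\<And>x. x \<in> topspace X \<Longrightarrow> \<bar>f x\<bar> \<le> C"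
proof -
  have "compact (f ` topspace X)"
    using image_compactin[of X "topspace X" euclideanreal f] assms
    by (simp add: compact_space_def)
  then obtain C where "\<forall>y\<in>f ` topspace X. norm y \<le> C"
    using compact_imp_bounded bounded_iff by metis
  then show thesis
    by (intro that[of "max 0 C"]) force+
qed

section \<open>A weakly* null sequence that does not converge weakly\<close>

text \<open>The atoms \<open>(x n S, y i)\<close> are indexed by pairs \<open>(S, i)\<close>; the coefficient of an atom is read off
  from its index. For \<open>n = 0\<close> there are no atoms and this is the zero measure.\<close>
definition rademacher_measure ::
    "(nat \<Rightarrow> nat set \<Rightarrow> 'a) \<Rightarrow> (nat \<Rightarrow> 'b) \<Rightarrow> nat \<Rightarrow> ('a \<times> 'b) set \<Rightarrow> real" where
  "rademacher_measure x y n =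
     (let D = Pow {..<n} \<times> {..<n}; atom = (\<lambda>(S, i). (x n S, y i)) in
      finite_atomic (atom ` D)
        (\<lambda>p. case inv_into D atom p of (S, i) \<Rightarrow> sign_of S i / (n * 2 ^ n)))"

text \<open>Injectivity in \<open>n\<close> and \<open>S\<close> together makes the supports for different \<open>n\<close> disjoint, which is
  what the failure of weak convergence rests on.\<close>
definition injective_grid :: "('a topology) \<Rightarrow> ('b topology) \<Rightarrow> (nat \<Rightarrow> nat set \<Rightarrow> 'a) \<Rightarrow> (nat \<Rightarrow> 'b) \<Rightarrow> bool" where
  "injective_grid K L x y \<longleftrightarrow>
     (\<forall>n S. finite S \<longrightarrow> x n S \<in> topspace K) \<and>
     (\<forall>m n S T. finite S \<longrightarrow> finite T \<longrightarrow> x m S = x n T \<longrightarrow> m = n \<and> S = T) \<and>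
     range y \<subseteq> topspace L \<and> inj y"

lemma injective_grid_exists:
  fixes K :: "'a topology" and L :: "'b topology"
  assumes "infinite (topspace K)" "infinite (topspace L)"
  obtains x y where "injective_grid K L x y"
proof -
  obtain u :: "nat \<Rightarrow> 'a" where u: "inj u" "range u \<subseteq> topspace K"
    using infinite_countable_subset[OF assms(1)] by blast
  obtain y :: "nat \<Rightarrow> 'b" where y: "inj y" "range y \<subseteq> topspace L"
    using infinite_countable_subset[OF assms(2)] by blast
  have "injective_grid K L (\<lambda>n S. u (prod_encode (n, set_encode S))) y"
    unfolding injective_grid_def
  proof (intro conjI allI impI)
    fix m n and S T :: "nat set"
    assume "finite S" "finite T"
      and "u (prod_encode (m, set_encode S)) = u (prod_encode (n, set_encode T))"
    then show "m = n" "S = T"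
      using u(1) by (simp_all add: inj_eq set_encode_eq)
  qed (use u y in auto)
  then show thesis by (rule that)
qed

context
  fixes K :: "'a topology" and L :: "'b topology" and x :: "nat \<Rightarrow> nat set \<Rightarrow> 'a" and y :: "nat \<Rightarrow> 'b"
  assumes grid: "injective_grid K L x y"
begin

lemma grid_in_topspace: "S \<subseteq> {..<n} \<Longrightarrow> x n S \<in> topspace K" "y i \<in> topspace L"
  using grid finite_subset[of S "{..<n}"] by (auto simp: injective_grid_def)

lemma inj_atoms: "inj_on (\<lambda>(S, i). (x n S, y i)) (Pow {..<n} \<times> {..<n})"
proof (rule inj_onI, clarify)
  fix S T i j
  assume "S \<subseteq> {..<n}" "T \<subseteq> {..<n}" "x n S = x n T" "y i = y j"
  then show "S = T \<and> i = j"
    using grid unfolding injective_grid_def inj_def by (meson finite_lessThan finite_subset)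
qed

lemma atoms_subset:
  "(\<lambda>(S, i). (x n S, y i)) ` (Pow {..<n} \<times> {..<n}) \<subseteq> topspace (prod_topology K L)"
  by (auto simp: grid_in_topspace)

lemma sum_rademacher_atoms:
  fixes n f
  defines "D \<equiv> Pow {..<n} \<times> {..<n}" and "atom \<equiv> \<lambda>(S, i). (x n S, y i)"
  shows "(\<Sum>p\<in>atom ` D. (case inv_into D atom p of (S, i) \<Rightarrow> sign_of S i / (n * 2 ^ n)) * f p)
    = (\<Sum>S\<in>Pow {..<n}. \<Sum>i<n. sign_of S i * f (x n S, y i)) / (n * 2 ^ n)"
proof -
  have inj: "inj_on atom D"
    unfolding atom_def D_def by (rule inj_atoms)
  have "(\<Sum>p\<in>atom ` D. (case inv_into D atom p of (S, i) \<Rightarrow> sign_of S i / (n * 2 ^ n)) * f p)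
      = (\<Sum>d\<in>D. (case d of (S, i) \<Rightarrow> sign_of S i / (n * 2 ^ n)) * f (atom d))"
    using inj by (simp add: sum.reindex)
  also have "\<dots> = (\<Sum>(S, i)\<in>D. sign_of S i / (n * 2 ^ n) * f (x n S, y i))"
    by (intro sum.cong) (auto simp: atom_def)
  also have "\<dots> = (\<Sum>S\<in>Pow {..<n}. \<Sum>i<n. sign_of S i / (n * 2 ^ n) * f (x n S, y i))"
    unfolding D_def by (simp add: sum.cartesian_product)
  finally show ?thesis
    by (simp add: sum_divide_distrib)
qed

lemma rademacher_measure_apply:
  "rademacher_measure x y n B
    = (\<Sum>S\<in>Pow {..<n}. \<Sum>i<n. sign_of S i * indicator B (x n S, y i)) / (n * 2 ^ n)"
  unfolding rademacher_measure_def Let_def finite_atomic_def by (rule sum_rademacher_atoms)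

lemma rademacher_measure_in_l1_measures:
  assumes "t1_space (prod_topology K L)"
  shows "rademacher_measure x y n \<in> l1_measures (prod_topology K L)"
  unfolding rademacher_measure_def Let_def
  by (intro finite_atomic_in_l1_measures assms atoms_subset) auto

lemma signed_integral_rademacher_measure:
  assumes "t1_space (prod_topology K L)" "continuous_map (prod_topology K L) euclideanreal f"
  shows "signed_integral (prod_topology K L) (rademacher_measure x y n) f
    = (\<Sum>S\<in>Pow {..<n}. \<Sum>i<n. sign_of S i * f (x n S, y i)) / (n * 2 ^ n)"
  unfolding rademacher_measure_def Let_def
  by (subst signed_integral_finite_atomic[OF assms(1) _ atoms_subset assms(2)])
    (simp, rule sum_rademacher_atoms)

lemma rademacher_integral_bound:
  fixes f :: "'a \<times> 'b \<Rightarrow> real" and C e :: real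
  assumes J: "finite J" "J \<subseteq> topspace K"
    and net: "\<And>x. x \<in> topspace K \<Longrightarrow> \<exists>j\<in>J. \<forall>y\<in>topspace L. \<bar>f (x, y) - f (j, y)\<bar> < e"
    and C: "0 \<le> C" "\<And>z. z \<in> topspace (prod_topology K L) \<Longrightarrow> \<bar>f z\<bar> \<le> C"
    and "0 < n"
  shows "\<bar>(\<Sum>S\<in>Pow {..<n}. \<Sum>i<n. sign_of S i * f (x n S, y i)) / (n * 2 ^ n)\<bar>
    \<le> card J * C / sqrt n + e"
proof -
  have "\<bar>\<Sum>S\<in>Pow {..<n}. \<Sum>i<n. sign_of S i * f (x n S, y i)\<bar>
      \<le> (\<Sum>S\<in>Pow {..<n}. \<bar>\<Sum>i<n. sign_of S i * f (x n S, y i)\<bar>)"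
    by (rule sum_abs)
  also have "\<dots> \<le> 2 ^ card {..<n} * (card J * (sqrt (card {..<n}) * C) + card {..<n} * e)"
  proof (rule sum_abs_sign_sum_le[where h = "\<lambda>j i. f (j, y i)"])
    show "\<exists>j\<in>J. \<forall>i\<in>{..<n}. \<bar>f (x n S, y i) - f (j, y i)\<bar> \<le> e" if "S \<subseteq> {..<n}" for S
      using net[OF grid_in_topspace(1)[OF that]] grid_in_topspace(2) by (meson less_imp_le)
  qed (use J C grid_in_topspace(2) in auto)
  finally have "\<bar>\<Sum>S\<in>Pow {..<n}. \<Sum>i<n. sign_of S i * f (x n S, y i)\<bar> / (n * 2 ^ n)
      \<le> 2 ^ n * (card J * (sqrt n * C) + n * e) / (n * 2 ^ n)"
    by (intro divide_right_mono) auto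
  also have "\<dots> = (card J * (sqrt n * C) + n * e) / n"
    by simp
  also have "\<dots> = card J * C * (sqrt n / n) + e"
    using \<open>0 < n\<close> by (simp add: field_simps)
  also have "sqrt n / n = 1 / sqrt n"
    by (simp add: real_div_sqrt sqrt_divide_self_eq inverse_eq_divide)
  finally show ?thesis
    by simp
qed

text \<open>In \<open>rademacher_integral_bound\<close> the number of sections in the net depends on \<open>e\<close> but not on
  \<open>n\<close>, so the first summand tends to \<open>0\<close> for each fixed \<open>e\<close>. The empty family of atoms represents
  the zero measure as limit.\<close>
lemma rademacher_measure_weak_star_null:
  assumes "compact_space K" "compact_space L" and T1: "t1_space (prod_topology K L)"
  shows "weak_star_converges_to (prod_topology K L) (rademacher_measure x y) (finite_atomic {} \<alpha>)"
  unfolding weak_star_converges_to_def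
proof (intro allI impI)
  fix f assume f: "continuous_map (prod_topology K L) euclideanreal f"
  have "compact_space (prod_topology K L)"
    using assms by (simp add: compact_space_prod_topology)
  then obtain C where C: "0 \<le> C" "\<And>z. z \<in> topspace (prod_topology K L) \<Longrightarrow> \<bar>f z\<bar> \<le> C"
    using f by (rule bounded_continuous_map_compact) blast
  let ?I = "\<lambda>n. (\<Sum>S\<in>Pow {..<n}. \<Sum>i<n. sign_of S i * f (x n S, y i)) / (real n * 2 ^ n)"
  have "?I \<longlonglongrightarrow> 0"
  proof (rule tendstoI)
    fix e :: real assume "0 < e"
    then obtain J where J: "finite J" "J \<subseteq> topspace K"
      "\<And>x. x \<in> topspace K \<Longrightarrow> \<exists>j\<in>J. \<forall>y\<in>topspace L. \<bar>f (x, y) - f (j, y)\<bar> < e / 2"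
      using finite_net_of_sections[OF assms(1,2) f, of "e / 2"] by auto
    have "(\<lambda>n. card J * C / sqrt (real n)) \<longlonglongrightarrow> 0"
      by (intro tendsto_divide_0[OF tendsto_const] filterlim_at_top_imp_at_infinity
          filterlim_compose[OF sqrt_at_top filterlim_real_sequentially])
    then have "\<forall>\<^sub>F n in sequentially. card J * C / sqrt (real n) < e / 2"
      using \<open>0 < e\<close> by (intro order_tendstoD) auto
    then show "\<forall>\<^sub>F n in sequentially. dist (?I n) 0 < e"
      using eventually_gt_at_top[of 0]
    proof eventually_elim
      case (elim n)
      have "\<bar>?I n\<bar> \<le> card J * C / sqrt n + e / 2"
        by (rule rademacher_integral_bound) (use J C elim in auto)
      then show ?case
        using elim unfolding dist_real_def diff_0_right by linarith
    qed
  qed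
  then show "(\<lambda>n. signed_integral (prod_topology K L) (rademacher_measure x y n) f)
      \<longlonglongrightarrow> signed_integral (prod_topology K L) (finite_atomic {} \<alpha>) f"
    using T1 f by (simp add: signed_integral_rademacher_measure signed_integral_finite_atomic)
qed

definition positive_atoms :: "nat set \<Rightarrow> ('a \<times> 'b) set" where
  "positive_atoms N = {(x n S, y i) | n S i. n \<in> N \<and> S \<subseteq> {..<n} \<and> i \<in> S}"

lemma countable_positive_atoms: "countable (positive_atoms N)"
proof -
  have "positive_atoms N \<subseteq> (\<Union>n. \<Union>S\<in>Pow {..<n}. range (\<lambda>i. (x n S, y i)))"
    by (auto simp: positive_atoms_def)
  moreover have "countable (\<Union>n. \<Union>S\<in>Pow {..<n}. range (\<lambda>i. (x n S, y i)))"
    by (auto intro!: countable_UN intro: countable_finite)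
  ultimately show ?thesis
    by (rule countable_subset)
qed

lemma positive_atoms_subset: "positive_atoms N \<subseteq> topspace (prod_topology K L)"
  by (auto simp: positive_atoms_def grid_in_topspace)

text \<open>Exactly half of the total variation of each measure is positive, since on average a
  subset of \<open>{..<n}\<close> has \<open>n / 2\<close> elements.\<close>
lemma rademacher_measure_positive_atoms:
  "rademacher_measure x y n (positive_atoms N) = (if n \<in> N \<and> 0 < n then 1 / 2 else 0)"
proof -
  have mem: "(x n S, y i) \<in> positive_atoms N \<longleftrightarrow> n \<in> N \<and> i \<in> S" if S: "S \<subseteq> {..<n}" for S i
  proof
    assume "(x n S, y i) \<in> positive_atoms N"
    then obtain m T j where mTj: "x n S = x m T" "y i = y j" "m \<in> N" "T \<subseteq> {..<m}" "j \<in> T"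
      by (auto simp: positive_atoms_def)
    moreover have "finite S" "finite T"
      using S mTj by (auto intro: finite_subset)
    ultimately show "n \<in> N \<and> i \<in> S"
      using grid unfolding injective_grid_def inj_def by metis
  next
    assume "n \<in> N \<and> i \<in> S"
    then show "(x n S, y i) \<in> positive_atoms N"
      using S by (auto simp: positive_atoms_def)
  qed
  have "(\<Sum>i<n. sign_of S i * indicator (positive_atoms N) (x n S, y i))
      = (if n \<in> N then real (card S) else 0)" if S: "S \<in> Pow {..<n}" for S
  proof -
    have "(\<Sum>i<n. sign_of S i * indicator (positive_atoms N) (x n S, y i))
        = (\<Sum>i<n. if i \<in> S then (if n \<in> N then 1 else 0) else 0)"
      using S by (intro sum.cong) (auto simp: mem sign_of_def indicator_def)
    also have "\<dots> = (\<Sum>i\<in>S. if n \<in> N then 1 else 0)"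
      using S by (intro sum.mono_neutral_cong_right) auto
    finally show ?thesis by simp
  qed
  then have "rademacher_measure x y n (positive_atoms N)
      = (if n \<in> N then (\<Sum>S\<in>Pow {..<n}. real (card S)) / (n * 2 ^ n) else 0)"
    by (simp add: rademacher_measure_apply)
  also have "(\<Sum>S\<in>Pow {..<n}. real (card S)) = n * 2 ^ n / 2"
    using sum_card_Pow[of "{..<n}"] by simp
  finally show ?thesis by auto
qed

text \<open>The Borel set that collects the positive atoms of even index separates the limits along even
  and along odd indices.\<close>
lemma rademacher_measure_not_weakly_convergent:
  assumes T1: "t1_space (prod_topology K L)"
  shows "\<not> weakly_converges_to (prod_topology K L) (rademacher_measure x y) \<nu>"
proof
  let ?B = "positive_atoms {n. even n}"
  assume "weakly_converges_to (prod_topology K L) (rademacher_measure x y) \<nu>"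
  moreover have "?B \<in> borel_sets_of (prod_topology K L)"
    by (intro borel_sets_of_countable T1 countable_positive_atoms positive_atoms_subset)
  ultimately have lim: "(\<lambda>n. rademacher_measure x y n ?B) \<longlonglongrightarrow> \<nu> ?B"
    by (auto simp: weakly_converges_to_def)
  \<comment> \<open>The even subsequence starts at \<open>2\<close>, as the measure of index \<open>0\<close> vanishes.\<close>
  have "strict_mono (\<lambda>k::nat. 2 * k + 2)" "strict_mono (\<lambda>k::nat. 2 * k + 1)"
    by (auto simp: strict_mono_def)
  from LIMSEQ_subseq_LIMSEQ[OF lim this(1)] LIMSEQ_subseq_LIMSEQ[OF lim this(2)]
  have "\<nu> ?B = 1 / 2" "\<nu> ?B = 0"
    by (simp_all add: o_def rademacher_measure_positive_atoms LIMSEQ_const_iff)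
  then show False by simp
qed

end

theorem corollary11p4:
  fixes K :: "'a topology" and L :: "'b topology"
  assumes "compact_space K" and "Hausdorff_space K" and "infinite (topspace K)"
    and "compact_space L" and "Hausdorff_space L" and "infinite (topspace L)"
  shows "\<not> l1_Grothendieck_property (prod_topology K L)"
proof
  obtain x y where grid: "injective_grid K L x y"
    using injective_grid_exists[OF assms(3,6)] .
  have T1: "t1_space (prod_topology K L)"
    using assms by (intro Hausdorff_imp_t1_space) (simp add: Hausdorff_space_prod_topology)
  have "signed_Radon_measure (prod_topology K L) (finite_atomic {} (\<lambda>_. 0))"
    using T1 by (rule signed_Radon_measure_finite_atomic) auto
  moreover assume "l1_Grothendieck_property (prod_topology K L)"
  ultimately obtain \<nu> where "weakly_converges_to (prod_topology K L) (rademacher_measure x y) \<nu>"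
    using rademacher_measure_in_l1_measures[OF grid T1]
      rademacher_measure_weak_star_null[OF grid assms(1,4) T1]
    unfolding l1_Grothendieck_property_def by blast
  then show False
    using rademacher_measure_not_weakly_convergent[OF grid T1] by blast
qed

end
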